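(* Let $\mathcal X$ be a normed vector space, $\mathcal Y$ an inner product space, $T,T_n:\mathcal X\to\mathcal Y$ ($n=1,2,\dots$) bounded linear operators, $y,y_n\in\mathcal Y$, $\alpha>0$, $\alpha_n\in\mathbb R$, $\mathcal D$ a subset of $\mathcal X$, and $W:\mathcal D\to\mathbb R$ a functional satisfying: (1) there exists $\gamma\ge 0$ such that $W(x)\ge-\gamma$ for all $x\in\mathcal D$; (2) for every $T$-$W$-bounded sequence $\{x_n\}\subset\mathcal D$ converging weakly to some $x\in\mathcal D$, there exists a subsequence $\{x_{n_j}\}$ such that $W(x)\le\liminf_{j\to\infty}W(x_{n_j})$; (3) for every $T$-$W$-bounded sequence $\{x_n\}\subset\mathcal D$ there exist a subsequence $\{x_{n_j}\}$ and $x\in\mathcal D$ such that $x_{n_j}$ converges weakly to $x$. Define on $\mathcal D$ the functionals $$J(x)=\|Tx-y\|^2+\alpha W(x),\qquad J_n(x)=\|T_nx-y_n\|^2+\alpha_nW(x),\quad n=1,2,\dots,$$ and assume that as $n\to\infty$, $\alpha_n\to\alpha$, $y_n\to y$ and $T_nx\to Tx$ uniformly for $x$ in $W$-bounded sets. Suppose further that $J$ has a unique global minimizer $\bar x$ on $\mathcal D$. If, for each $n$, $x_n$ is a global minimizer of $J_n$ on $\mathcal D$, then $x_n$ converges weakly to $\bar x$.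
   Context: A sequence $\{x_n\}\subset\mathcal D$ is $T$-$W$-bounded if $\{\|Tx_n\|+W(x_n)\}$ is bounded in $\mathbb R$. A subset of $\mathcal D$ is $W$-bounded if there is a constant $k<\infty$ with $|W(x)|\le k$ for all its elements $x$. "$T_nx\to Tx$ uniformly for $x$ in $W$-bounded sets" means: for any $c>0$ and $\epsilon>0$ there exists $N$ such that $\|T_nx-Tx\|<\epsilon$ for every $n\ge N$ and every $x\in\mathcal D$ with $|W(x)|\le c$. *)

theory Defs
  imports "HOL-Analysis.Analysis"
begin

(* Real functionals suffice for complex spaces too: the bounded real-linear functionals are
   exactly the real parts of the bounded complex-linear ones. *)
definition weakly_converges :: "(nat \<Rightarrow> 'a::real_normed_vector) \<Rightarrow> 'a \<Rightarrow> bool" where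
  "weakly_converges u x \<longleftrightarrow>
     (\<forall>f :: 'a \<Rightarrow> real. bounded_linear f \<longrightarrow> (\<lambda>n. f (u n)) \<longlonglongrightarrow> f x)"

(* Functionals on D are total functions whose values outside D are never used. *)
definition TW_bounded_seq ::
  "'a set \<Rightarrow> ('a \<Rightarrow> 'b::real_normed_vector) \<Rightarrow> ('a \<Rightarrow> real) \<Rightarrow> (nat \<Rightarrow> 'a) \<Rightarrow> bool" where
  "TW_bounded_seq D T W u \<longleftrightarrow>
     (\<forall>n. u n \<in> D) \<and> bounded (range (\<lambda>n. norm (T (u n)) + W (u n)))"

definition tikhonov ::
  "('a \<Rightarrow> 'b::real_normed_vector) \<Rightarrow> 'b \<Rightarrow> real \<Rightarrow> ('a \<Rightarrow> real) \<Rightarrow> 'a \<Rightarrow> real" where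
  "tikhonov T y \<alpha> W x = (norm (T x - y))\<^sup>2 + \<alpha> * W x"

end

theory Submission
  imports Defs
begin

text \<open>
  The minimizers \<open>x\<^sub>n\<close> of the perturbed functionals \<open>J\<^sub>n\<close> form a minimizing sequence for the
  unperturbed functional \<open>J\<close>, and every minimizing sequence of \<open>J\<close> converges weakly to \<open>xbar\<close>.

  For the first claim, compare with the fixed competitor \<open>xbar\<close>: \<open>J\<^sub>n x\<^sub>n \<le> J\<^sub>n xbar\<close>, and the right-hand
  side tends to \<open>J xbar\<close>. Since \<open>W\<close> is bounded below and the \<open>\<alpha>\<^sub>n\<close> eventually stay away from \<open>0\<close>, this
  bounds both \<open>W x\<^sub>n\<close> and the residuals \<open>T\<^sub>n x\<^sub>n - y\<^sub>n\<close>. Hence the points \<open>x\<^sub>n\<close> eventually lie in one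
  \<open>W\<close>-bounded set, where \<open>T\<^sub>n\<close> is uniformly close to \<open>T\<close>; therefore \<open>J x\<^sub>n - J\<^sub>n x\<^sub>n \<rightarrow> 0\<close>, and
  \<open>J x\<^sub>n\<close> is squeezed to the minimum (\<open>perturbed_minimizers_minimizing\<close>).

  For the second claim, a minimizing sequence is bounded in the sense required by the compactness
  hypothesis, so each of its subsequences has a weakly convergent subsequence. The functional \<open>J\<close> is
  weakly lower semicontinuous along a further subsequence (\<open>tikhonov_weak_lsc\<close>), so the weak limit
  minimizes \<open>J\<close> and must be \<open>xbar\<close>. As the limit does not depend on the subsequence, the whole
  sequence converges weakly (\<open>minimizing_sequence_weakly_converges\<close>).
\<close>

section \<open>Weak convergence and subsequences\<close>

lemma weakly_converges_subseq:
  assumes "weakly_converges u x" "strict_mono r"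
  shows "weakly_converges (u \<circ> r) x"
  using assms LIMSEQ_subseq_LIMSEQ unfolding weakly_converges_def comp_def by fastforce

lemma weakly_converges_offset:
  assumes "weakly_converges (\<lambda>n. u (n + k)) x"
  shows "weakly_converges u x"
  unfolding weakly_converges_def
proof (intro allI impI)
  fix f :: "'a \<Rightarrow> real" assume "bounded_linear f"
  then have "(\<lambda>n. f (u (n + k))) \<longlonglongrightarrow> f x" using assms by (simp add: weakly_converges_def)
  then show "(\<lambda>n. f (u n)) \<longlonglongrightarrow> f x" by (rule LIMSEQ_offset)
qed

text \<open>
  The weak topology need not be metrizable, so the sub-subsequence principle is applied to each real
  sequence \<open>f (u n)\<close> separately: the subsequence \<open>r\<close> that stays away from the limit depends on \<open>f\<close>.
\<close>

lemma weakly_converges_if_subsubseq: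
  fixes u :: "nat \<Rightarrow> 'a::real_normed_vector"
  assumes sub: "\<And>r :: nat \<Rightarrow> nat. strict_mono r \<Longrightarrow>
    \<exists>s :: nat \<Rightarrow> nat. strict_mono s \<and> weakly_converges (u \<circ> r \<circ> s) x"
  shows "weakly_converges u x"
  unfolding weakly_converges_def
proof (intro allI impI)
  fix f :: "'a \<Rightarrow> real" assume f: "bounded_linear f"
  show "(\<lambda>n. f (u n)) \<longlonglongrightarrow> f x"
  proof (rule ccontr)
    assume "\<not> ?thesis"
    then obtain e where e: "e > 0" "\<not> (\<forall>\<^sub>F n in sequentially. dist (f (u n)) (f x) < e)"
      unfolding tendsto_iff by blast
    from e(2) have "infinite {n. \<not> dist (f (u n)) (f x) < e}"
      by (simp add: cofinite_eq_sequentially[symmetric] eventually_cofinite)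
    from infinite_enumerate[OF this] obtain r :: "nat \<Rightarrow> nat"
      where r: "strict_mono r" "\<And>n. \<not> dist (f (u (r n))) (f x) < e"
      by blast
    obtain s :: "nat \<Rightarrow> nat" where "weakly_converges (u \<circ> r \<circ> s) x" using sub[OF r(1)] by blast
    then have "(\<lambda>n. f (u (r (s n)))) \<longlonglongrightarrow> f x" using f by (simp add: weakly_converges_def)
    then have "\<forall>\<^sub>F n in sequentially. dist (f (u (r (s n)))) (f x) < e"
      using e(1) by (simp add: tendsto_iff)
    then show False using r(2) by simp
  qed
qed

section \<open>Minimizing sequences\<close>

text \<open>
  The squared residual is convex, hence bounded below by its linearization at the weak limit \<open>x\<close>:
  \<open>\<parallel>T v - y\<parallel>\<^sup>2 \<ge> \<parallel>T x - y\<parallel>\<^sup>2 + 2 \<langle>T v - T x, T x - y\<rangle>\<close>. The linear term is a bounded functional of \<open>v\<close>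
  and so vanishes in the weak limit.
\<close>

lemma tikhonov_weak_lsc:
  fixes T :: "'a::real_normed_vector \<Rightarrow> 'b::real_inner"
  assumes T: "bounded_linear T" and \<alpha>: "\<alpha> \<ge> 0"
    and u: "weakly_converges u x"
    and W: "ereal (W x) \<le> liminf (\<lambda>j. ereal (W (u j)))"
    and L: "(\<lambda>j. tikhonov T y \<alpha> W (u j)) \<longlonglongrightarrow> L"
  shows "tikhonov T y \<alpha> W x \<le> L"
proof -
  have "bounded_linear (\<lambda>v. inner (T v) (T x - y))"
    using bounded_linear_compose[OF bounded_linear_inner_left T] by simp
  then have inner_lim: "(\<lambda>j. inner (T (u j)) (T x - y)) \<longlonglongrightarrow> inner (T x) (T x - y)"
    using u unfolding weakly_converges_def by blast
  have linearization:
    "(norm (T v - y))\<^sup>2 \<ge> (norm (T x - y))\<^sup>2 + 2 * (inner (T v) (T x - y) - inner (T x) (T x - y))" for v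
  proof -
    have "(norm (T v - y))\<^sup>2 - (norm (T x - y))\<^sup>2
        - 2 * (inner (T v) (T x - y) - inner (T x) (T x - y)) = (norm (T v - T x))\<^sup>2"
      unfolding power2_norm_eq_inner
      by (simp add: inner_diff_left inner_diff_right inner_commute)
    then show ?thesis using zero_le_power2[of "norm (T v - T x)"] by linarith
  qed
  have approx: "tikhonov T y \<alpha> W x - \<alpha> * e \<le> L" if e: "e > 0" for e
  proof (rule tendsto_le[OF _ L])
    show "(\<lambda>j. (norm (T x - y))\<^sup>2 + 2 * (inner (T (u j)) (T x - y) - inner (T x) (T x - y))
            + \<alpha> * (W x - e)) \<longlonglongrightarrow> tikhonov T y \<alpha> W x - \<alpha> * e"
      by (rule tendsto_eq_intros inner_lim refl)+ (simp add: tikhonov_def algebra_simps)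
    have "ereal (W x - e) < liminf (\<lambda>j. ereal (W (u j)))"
      using e by (intro less_le_trans[OF _ W]) simp
    then have "\<forall>\<^sub>F j in sequentially. ereal (W x - e) < ereal (W (u j))"
      by (rule less_LiminfD)
    then show "\<forall>\<^sub>F j in sequentially. (norm (T x - y))\<^sup>2
        + 2 * (inner (T (u j)) (T x - y) - inner (T x) (T x - y)) + \<alpha> * (W x - e)
        \<le> tikhonov T y \<alpha> W (u j)"
    proof eventually_elim
      case (elim j)
      then have "\<alpha> * (W x - e) \<le> \<alpha> * W (u j)" using \<alpha> by (intro mult_left_mono) auto
      then show ?case using linearization[of "u j"] by (simp add: tikhonov_def)
    qed
  qed simp
  have "((\<lambda>e. tikhonov T y \<alpha> W x - \<alpha> * e) \<longlongrightarrow> tikhonov T y \<alpha> W x) (at_right 0)"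
    by (rule tendsto_eq_intros refl)+ simp
  then show ?thesis
    by (rule tendsto_upperbound) (auto simp: eventually_at_filter approx)
qed

text \<open>
  A bound on \<open>J\<close> bounds the residual and \<open>W\<close> separately, because \<open>W\<close> is bounded below and \<open>\<alpha>\<close> is
  positive.
\<close>

lemma TW_bounded_seq_if_tikhonov_bounded:
  fixes T :: "'a::real_normed_vector \<Rightarrow> 'b::real_inner"
  assumes \<alpha>: "\<alpha> > 0" and W_below: "\<And>x. x \<in> D \<Longrightarrow> W x \<ge> - \<gamma>"
    and D: "\<And>n. u n \<in> D" and J: "\<And>n. tikhonov T y \<alpha> W (u n) \<le> C"
  shows "TW_bounded_seq D T W u"
  unfolding TW_bounded_seq_def
proof (intro conjI allI D)
  have "\<bar>norm (T (u n)) + W (u n)\<bar> \<le> (sqrt (C + \<alpha> * \<gamma>) + norm y) + (\<bar>C / \<alpha>\<bar> + \<bar>\<gamma>\<bar>)" for n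
  proof -
    have lower: "- \<gamma> \<le> W (u n)" using W_below D by blast
    then have "\<alpha> * (- \<gamma>) \<le> \<alpha> * W (u n)" using \<alpha> by (intro mult_left_mono) auto
    then have "(norm (T (u n) - y))\<^sup>2 \<le> C + \<alpha> * \<gamma>" using J[of n] by (simp add: tikhonov_def)
    then have "norm (T (u n) - y) \<le> sqrt (C + \<alpha> * \<gamma>)" by (rule real_le_rsqrt)
    then have Tu: "norm (T (u n)) \<le> sqrt (C + \<alpha> * \<gamma>) + norm y"
      using norm_triangle_sub[of "T (u n)" y] by linarith
    have "\<alpha> * W (u n) \<le> C"
      using J[of n] zero_le_power2[of "norm (T (u n) - y)"] unfolding tikhonov_def by linarith
    then have "W (u n) \<le> C / \<alpha>" using \<alpha> by (simp add: field_simps)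
    then show ?thesis using lower Tu norm_ge_zero[of "T (u n)"] by linarith
  qed
  then show "bounded (range (\<lambda>n. norm (T (u n)) + W (u n)))"
    unfolding bounded_iff by auto
qed

theorem minimizing_sequence_weakly_converges:
  fixes T :: "'a::real_normed_vector \<Rightarrow> 'b::real_inner"
  assumes T: "bounded_linear T" and \<alpha>: "\<alpha> > 0"
    and W_below: "\<And>x. x \<in> D \<Longrightarrow> W x \<ge> - \<gamma>"
    and W_lsc: "\<And>u x. TW_bounded_seq D T W u \<Longrightarrow> x \<in> D \<Longrightarrow> weakly_converges u x \<Longrightarrow>
       \<exists>r :: nat \<Rightarrow> nat. strict_mono r \<and> ereal (W x) \<le> liminf (\<lambda>j. ereal (W (u (r j))))"
    and W_compact: "\<And>u. TW_bounded_seq D T W u \<Longrightarrow>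
       \<exists>(r :: nat \<Rightarrow> nat) x. strict_mono r \<and> x \<in> D \<and> weakly_converges (u \<circ> r) x"
    and xbar: "is_arg_min (tikhonov T y \<alpha> W) (\<lambda>x. x \<in> D) xbar"
    and unique: "\<And>z. is_arg_min (tikhonov T y \<alpha> W) (\<lambda>x. x \<in> D) z \<Longrightarrow> z = xbar"
    and D: "\<And>n. u n \<in> D"
    and lim: "(\<lambda>n. tikhonov T y \<alpha> W (u n)) \<longlonglongrightarrow> tikhonov T y \<alpha> W xbar"
  shows "weakly_converges u xbar"
proof (rule weakly_converges_if_subsubseq)
  fix r :: "nat \<Rightarrow> nat" assume r: "strict_mono r"
  obtain C where C: "\<And>n. \<bar>tikhonov T y \<alpha> W (u n)\<bar> \<le> C"
    using convergent_imp_Bseq[OF convergentI[OF lim]] by (auto simp: Bseq_def)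
  then have "tikhonov T y \<alpha> W (u n) \<le> C" for n using abs_le_D1 by blast
  then have bounded: "TW_bounded_seq D T W (\<lambda>n. u (t n))" for t :: "nat \<Rightarrow> nat"
    by (intro TW_bounded_seq_if_tikhonov_bounded[OF \<alpha> W_below D])
  obtain s :: "nat \<Rightarrow> nat" and x
    where s: "strict_mono s" "x \<in> D" "weakly_converges (u \<circ> r \<circ> s) x"
    using W_compact[OF bounded[of r]] by (auto simp: comp_def)
  obtain t :: "nat \<Rightarrow> nat"
    where t: "strict_mono t" "ereal (W x) \<le> liminf (\<lambda>j. ereal (W (u (r (s (t j))))))"
    using W_lsc[OF bounded[of "r \<circ> s"] s(2)] s(3) by (auto simp: comp_def)
  have "strict_mono (r \<circ> s \<circ> t)" using r s(1) t(1) by (simp add: strict_mono_o)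
  then have "(\<lambda>j. tikhonov T y \<alpha> W (u (r (s (t j))))) \<longlonglongrightarrow> tikhonov T y \<alpha> W xbar"
    using LIMSEQ_subseq_LIMSEQ[OF lim] by (simp add: comp_def)
  then have "tikhonov T y \<alpha> W x \<le> tikhonov T y \<alpha> W xbar"
    using tikhonov_weak_lsc[OF T _ weakly_converges_subseq[OF s(3) t(1)]] \<alpha> t(2)
    by (simp add: comp_def)
  then have "is_arg_min (tikhonov T y \<alpha> W) (\<lambda>x. x \<in> D) x"
    using xbar s(2) unfolding is_arg_min_def by fastforce
  then have "x = xbar" by (rule unique)
  then show "\<exists>s :: nat \<Rightarrow> nat. strict_mono s \<and> weakly_converges (u \<circ> r \<circ> s) xbar"
    using s by blast
qed

section \<open>Minimizers of perturbed functionals\<close>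

text \<open>
  The comparison \<open>J\<^sub>n x\<^sub>n \<le> J\<^sub>n xbar\<close> yields the a priori bound that makes the uniform convergence
  on \<open>W\<close>-bounded sets applicable at the moving points \<open>x\<^sub>n\<close>.
\<close>

lemma perturbed_minimizers_minimizing:
  fixes T :: "'a \<Rightarrow> 'b::real_inner"
  assumes \<alpha>: "\<alpha> > 0" and W_below: "\<And>x. x \<in> D \<Longrightarrow> W x \<ge> - \<gamma>"
    and alpha_lim: "\<alpha>n \<longlonglongrightarrow> \<alpha>" and y_lim: "yn \<longlonglongrightarrow> y"
    and T_lim: "\<And>c. c > 0 \<Longrightarrow> uniform_limit {x \<in> D. \<bar>W x\<bar> \<le> c} Tn T sequentially"
    and xbar: "is_arg_min (tikhonov T y \<alpha> W) (\<lambda>x. x \<in> D) xbar"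
    and xn_D: "\<forall>\<^sub>F n in sequentially. xn n \<in> D"
    and xn_le: "\<forall>\<^sub>F n in sequentially.
      tikhonov (Tn n) (yn n) (\<alpha>n n) W (xn n) \<le> tikhonov (Tn n) (yn n) (\<alpha>n n) W xbar"
  shows "(\<lambda>n. tikhonov T y \<alpha> W (xn n)) \<longlonglongrightarrow> tikhonov T y \<alpha> W xbar"
proof -
  define J where "J = tikhonov T y \<alpha> W"
  define Jn where "Jn n = tikhonov (Tn n) (yn n) (\<alpha>n n) W" for n
  have xbar_D: "xbar \<in> D" and xbar_min: "\<And>x. x \<in> D \<Longrightarrow> J xbar \<le> J x"
    using xbar unfolding is_arg_min_def J_def by (auto simp: not_less)
  have "(\<lambda>n. Tn n xbar) \<longlonglongrightarrow> T xbar"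
    by (rule tendsto_uniform_limitI[OF T_lim[of "\<bar>W xbar\<bar> + 1"]]) (use xbar_D in auto)
  then have Jn_xbar: "(\<lambda>n. Jn n xbar) \<longlonglongrightarrow> J xbar"
    unfolding Jn_def J_def tikhonov_def using alpha_lim y_lim by (intro tendsto_intros)

  define C where "C = \<bar>J xbar\<bar> + 1"
  have "\<forall>\<^sub>F n in sequentially. Jn n xbar < C"
    using Jn_xbar by (rule order_tendstoD) (simp add: C_def)
  moreover have "\<forall>\<^sub>F n in sequentially. \<alpha>n n > \<alpha> / 2"
    using alpha_lim by (rule order_tendstoD) (use \<alpha> in simp)
  moreover have "\<forall>\<^sub>F n in sequentially. \<alpha>n n < 2 * \<alpha>"
    using alpha_lim by (rule order_tendstoD) (use \<alpha> in simp)
  \<comment> \<open>The lower bound on \<open>\<alpha>n\<close> turns a bound on \<open>Jn\<close> into one on \<open>W\<close>; the upper bound limits how far a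
     negative \<open>W\<close> can hide a large residual.\<close>
  ultimately have bounds: "\<forall>\<^sub>F n in sequentially. xn n \<in> D \<and> \<bar>W (xn n)\<bar> \<le> 2 * C / \<alpha> + \<bar>\<gamma>\<bar> \<and>
      norm (Tn n (xn n) - yn n) \<le> sqrt (C + 2 * \<alpha> * \<bar>\<gamma>\<bar>)"
    using xn_D xn_le
  proof eventually_elim
    case (elim n)
    have C: "(norm (Tn n (xn n) - yn n))\<^sup>2 + \<alpha>n n * W (xn n) \<le> C"
      using elim unfolding Jn_def tikhonov_def by linarith
    have lower: "- \<bar>\<gamma>\<bar> \<le> W (xn n)" using W_below elim abs_ge_self[of \<gamma>] by fastforce
    have "W (xn n) \<le> 2 * C / \<alpha>"
    proof (cases "W (xn n) \<le> 0")
      case True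
      also have "0 \<le> 2 * C / \<alpha>" using \<alpha> by (simp add: C_def)
      finally show ?thesis .
    next
      case False
      then have "\<alpha> / 2 * W (xn n) \<le> \<alpha>n n * W (xn n)" using elim by (intro mult_right_mono) auto
      also have "\<dots> \<le> C" using C zero_le_power2[of "norm (Tn n (xn n) - yn n)"] by linarith
      finally show ?thesis using \<alpha> by (simp add: field_simps)
    qed
    moreover have "0 \<le> 2 * C / \<alpha>" using \<alpha> by (simp add: C_def)
    ultimately have W: "\<bar>W (xn n)\<bar> \<le> 2 * C / \<alpha> + \<bar>\<gamma>\<bar>" using lower by linarith
    have "\<alpha>n n * \<bar>\<gamma>\<bar> \<le> 2 * \<alpha> * \<bar>\<gamma>\<bar>" using elim by (intro mult_right_mono) auto
    moreover have "\<alpha>n n * (- \<bar>\<gamma>\<bar>) \<le> \<alpha>n n * W (xn n)"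
      using elim \<alpha> lower by (intro mult_left_mono) auto
    ultimately have "(norm (Tn n (xn n) - yn n))\<^sup>2 \<le> C + 2 * \<alpha> * \<bar>\<gamma>\<bar>" using C by simp
    then show ?case using W elim real_le_rsqrt by blast
  qed
  define c where "c = 2 * C / \<alpha> + \<bar>\<gamma>\<bar>"
  have "c > 0" using \<alpha> by (simp add: c_def C_def add_pos_nonneg)

  \<comment> \<open>The residual of the unperturbed problem at \<open>xn n\<close> is \<open>a n + d n\<close>, where \<open>a n\<close> is the residual of the
     perturbed problem. As \<open>a\<close> is bounded and \<open>d\<close> vanishes, the squared norms of both residuals differ
     by a null sequence.\<close>
  define a where "a n = Tn n (xn n) - yn n" for n
  define d where "d n = (T (xn n) - y) - a n" for n
  have "(\<lambda>n. Tn n (xn n) - T (xn n)) \<longlonglongrightarrow> 0"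
    unfolding tendsto_iff
  proof (intro allI impI)
    fix e :: real assume "e > 0"
    with T_lim[OF \<open>c > 0\<close>]
    have "\<forall>\<^sub>F n in sequentially. \<forall>x\<in>{x \<in> D. \<bar>W x\<bar> \<le> c}. dist (Tn n x) (T x) < e"
      by (rule uniform_limitD)
    with bounds show "\<forall>\<^sub>F n in sequentially. dist (Tn n (xn n) - T (xn n)) 0 < e"
      by eventually_elim (auto simp: c_def dist_norm)
  qed
  then have "(\<lambda>n. (yn n - y) - (Tn n (xn n) - T (xn n))) \<longlonglongrightarrow> (y - y) - 0"
    using y_lim by (intro tendsto_intros)
  then have d: "d \<longlonglongrightarrow> 0" by (simp add: d_def[abs_def] a_def algebra_simps)
  have a: "Bfun a sequentially"
    using bounds by (intro BfunI[where K = "sqrt (C + 2 * \<alpha> * \<bar>\<gamma>\<bar>)"])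
      (auto simp: a_def elim: eventually_mono)
  have W: "Bfun (\<lambda>n. W (xn n)) sequentially"
    using bounds by (intro BfunI[where K = c]) (auto simp: c_def elim: eventually_mono)
  have gap: "(\<lambda>n. 2 * inner (d n) (a n) + (norm (d n))\<^sup>2 + (\<alpha> - \<alpha>n n) * W (xn n)) \<longlonglongrightarrow> 0"
  proof -
    have "Zfun (\<lambda>n. inner (d n) (a n)) sequentially"
      using d a by (intro bounded_bilinear.Zfun_prod_Bfun[OF bounded_bilinear_inner])
        (simp_all add: tendsto_Zfun_iff)
    moreover have "Zfun (\<lambda>n. (\<alpha> - \<alpha>n n) * W (xn n)) sequentially"
    proof (rule bounded_bilinear.Zfun_prod_Bfun[OF bounded_bilinear_mult _ W])
      have "(\<lambda>n. \<alpha> - \<alpha>n n) \<longlonglongrightarrow> \<alpha> - \<alpha>" using alpha_lim by (intro tendsto_intros)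
      then show "Zfun (\<lambda>n. \<alpha> - \<alpha>n n) sequentially" by (simp add: tendsto_Zfun_iff)
    qed
    ultimately have "(\<lambda>n. inner (d n) (a n)) \<longlonglongrightarrow> 0" "(\<lambda>n. (\<alpha> - \<alpha>n n) * W (xn n)) \<longlonglongrightarrow> 0"
      by (simp_all add: tendsto_Zfun_iff)
    from tendsto_add[OF tendsto_add[OF tendsto_mult_left[OF this(1), of 2]
          tendsto_power[OF tendsto_norm[OF d], of 2]] this(2)]
    show ?thesis by simp
  qed
  have J_eq: "J (xn n) = Jn n (xn n) + (2 * inner (d n) (a n) + (norm (d n))\<^sup>2 + (\<alpha> - \<alpha>n n) * W (xn n))"
    for n
  proof -
    have "T (xn n) - y = a n + d n" by (simp add: d_def)
    then have "(norm (T (xn n) - y))\<^sup>2 = (norm (a n))\<^sup>2 + 2 * inner (d n) (a n) + (norm (d n))\<^sup>2"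
      by (simp add: power2_norm_eq_inner inner_add_left inner_add_right inner_commute)
    moreover have "J (xn n) = (norm (T (xn n) - y))\<^sup>2 + \<alpha> * W (xn n)"
      by (simp add: J_def tikhonov_def)
    moreover have "Jn n (xn n) = (norm (a n))\<^sup>2 + \<alpha>n n * W (xn n)"
      by (simp add: Jn_def tikhonov_def a_def)
    ultimately show ?thesis by (simp add: left_diff_distrib)
  qed
  have "(\<lambda>n. J (xn n)) \<longlonglongrightarrow> J xbar"
  proof (rule tendsto_sandwich[OF _ _ tendsto_const])
    show "\<forall>\<^sub>F n in sequentially. J xbar \<le> J (xn n)"
      using xn_D by eventually_elim (rule xbar_min)
    show "\<forall>\<^sub>F n in sequentially. J (xn n)
        \<le> Jn n xbar + (2 * inner (d n) (a n) + (norm (d n))\<^sup>2 + (\<alpha> - \<alpha>n n) * W (xn n))"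
      using xn_le by eventually_elim (unfold J_eq Jn_def, rule add_right_mono)
    show "(\<lambda>n. Jn n xbar + (2 * inner (d n) (a n) + (norm (d n))\<^sup>2 + (\<alpha> - \<alpha>n n) * W (xn n)))
        \<longlonglongrightarrow> J xbar"
      using tendsto_add[OF Jn_xbar gap] by simp
  qed
  then show ?thesis by (simp add: J_def)
qed

section \<open>Weak stability of the regularized solutions\<close>

theorem corollary3p9:
  fixes T :: "'a::real_normed_vector \<Rightarrow> 'b::real_inner"
    and Tn :: "nat \<Rightarrow> 'a \<Rightarrow> 'b"
    and y :: 'b and yn :: "nat \<Rightarrow> 'b"
    and \<alpha> :: real and \<alpha>n :: "nat \<Rightarrow> real"
    and D :: "'a set" and W :: "'a \<Rightarrow> real"
    and xbar :: 'a and xn :: "nat \<Rightarrow> 'a"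
  assumes T: "bounded_linear T"
    and Tn: "\<And>n. n \<ge> 1 \<Longrightarrow> bounded_linear (Tn n)"
    and alpha_pos: "\<alpha> > 0"
    and W_below: "\<exists>\<gamma>\<ge>0. \<forall>x\<in>D. W x \<ge> - \<gamma>"
    and W_lsc: "\<And>u x. TW_bounded_seq D T W u \<Longrightarrow> x \<in> D \<Longrightarrow> weakly_converges u x \<Longrightarrow>
       \<exists>r :: nat \<Rightarrow> nat. strict_mono r \<and> ereal (W x) \<le> liminf (\<lambda>j. ereal (W (u (r j))))"
    and W_compact: "\<And>u. TW_bounded_seq D T W u \<Longrightarrow>
       \<exists>(r :: nat \<Rightarrow> nat) x. strict_mono r \<and> x \<in> D \<and> weakly_converges (u \<circ> r) x"
    and alpha_lim: "\<alpha>n \<longlonglongrightarrow> \<alpha>"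
    and y_lim: "yn \<longlonglongrightarrow> y"
    and T_lim: "\<And>c. c > 0 \<Longrightarrow> uniform_limit {x \<in> D. \<bar>W x\<bar> \<le> c} Tn T sequentially"
    and xbar: "is_arg_min (tikhonov T y \<alpha> W) (\<lambda>x. x \<in> D) xbar"
    and unique: "\<And>z. is_arg_min (tikhonov T y \<alpha> W) (\<lambda>x. x \<in> D) z \<Longrightarrow> z = xbar"
    and xn: "\<And>n. n \<ge> 1 \<Longrightarrow> is_arg_min (tikhonov (Tn n) (yn n) (\<alpha>n n) W) (\<lambda>x. x \<in> D) (xn n)"
  shows "weakly_converges xn xbar"
proof -
  obtain \<gamma> where W_ge: "\<And>x. x \<in> D \<Longrightarrow> W x \<ge> - \<gamma>" using W_below by blast
  have xn_D: "xn n \<in> D"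
    and xn_le: "tikhonov (Tn n) (yn n) (\<alpha>n n) W (xn n) \<le> tikhonov (Tn n) (yn n) (\<alpha>n n) W xbar"
    if "n \<ge> 1" for n
    using xn[OF that] xbar unfolding is_arg_min_def by (auto simp: not_less)
  have "(\<lambda>n. tikhonov T y \<alpha> W (xn n)) \<longlonglongrightarrow> tikhonov T y \<alpha> W xbar"
  proof (rule perturbed_minimizers_minimizing[OF alpha_pos W_ge alpha_lim y_lim T_lim xbar])
    show "\<forall>\<^sub>F n in sequentially. xn n \<in> D"
      using eventually_ge_at_top[of 1] by eventually_elim (rule xn_D)
    show "\<forall>\<^sub>F n in sequentially.
        tikhonov (Tn n) (yn n) (\<alpha>n n) W (xn n) \<le> tikhonov (Tn n) (yn n) (\<alpha>n n) W xbar"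
      using eventually_ge_at_top[of 1] by eventually_elim (rule xn_le)
  qed
  \<comment> \<open>The entry \<open>xn 0\<close> may lie outside \<open>D\<close>, so the sequence is started at index \<open>1\<close>.\<close>
  then have "(\<lambda>n. tikhonov T y \<alpha> W (xn (n + 1))) \<longlonglongrightarrow> tikhonov T y \<alpha> W xbar"
    by (rule LIMSEQ_ignore_initial_segment)
  moreover have "xn (n + 1) \<in> D" for n by (simp add: xn_D)
  ultimately have "weakly_converges (\<lambda>n. xn (n + 1)) xbar"
    by (intro minimizing_sequence_weakly_converges[OF T alpha_pos W_ge W_lsc W_compact xbar unique])
  then show ?thesis by (rule weakly_converges_offset)
qed

end
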